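(* Let $f:[0,\infty[\to\mathbb{R}$ be a càdlàg function. Then $f$ is Feller-expandable if and only if $f$ is Hunt-expandable.
   Context: A deterministic (time homogeneous, universal) Markov process on $\mathbb{R}$ is a family $(X^x)_{x\in\mathbb{R}}$ of functions (paths) $t\mapsto X_t^x$, $[0,\infty[\to\mathbb{R}$, not depending on $\omega$, with $X_0^x=x$ for every $x$, such that: whenever $X_s^x=X_t^y$ for some $s,t\ge 0$ and $x,y\in\mathbb{R}$, then $X_{s+h}^x=X_{t+h}^y$ for every $h\ge 0$. All paths are assumed to be càdlàg (right-continuous with left limits). A deterministic Markov process is a deterministic Hunt process if in addition it is quasi-left continuous for every starting point, which for deterministic processes is equivalent to left continuity of all paths. The semigroup of a deterministic Markov process is $T_tu(x)=\mathbb{E}^x u(X_t)=u(X_t^x)$ for bounded Borel measurable $u$. The process is called Feller if (F1) $T_t$ maps $C_\infty(\mathbb{R})$ into $C_\infty(\mathbb{R})$ for every $t\ge0$, and (F2) $\lim_{t\downarrow0}\|T_tu-u\|_\infty=0$ for every $u\in C_\infty(\mathbb{R})$, where $C_\infty(\mathbb{R})$ denotes the continuous real functions on $\mathbb{R}$ vanishing at infinity. $f$ is Hunt-expandable (respectively Feller-expandable) if there exists a deterministic Hunt (respectively Feller) process $(X^x)_{x\in\mathbb{R}}$ with $X_t^{f(0)}=f(t)$ for every $t\ge0$. *)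

theory Defs
  imports "HOL-Analysis.Analysis"
begin

text \<open>Paths are functions \<open>real \<Rightarrow> real\<close> of which only the restriction to \<open>[0,\<infinity>[\<close> matters:
  every condition below constrains them at nonnegative times only. A family of paths is written
  \<open>X x t\<close> for the position at time \<open>t\<close> of the path started at \<open>x\<close>.\<close>

definition cadlag :: "(real \<Rightarrow> real) \<Rightarrow> bool" where
  "cadlag f \<longleftrightarrow>
     (\<forall>t\<ge>0. (f \<longlongrightarrow> f t) (at_right t)) \<and>
     (\<forall>t>0. \<exists>l. (f \<longlongrightarrow> l) (at_left t))"

definition deterministic_markov :: "(real \<Rightarrow> real \<Rightarrow> real) \<Rightarrow> bool" where
  "deterministic_markov X \<longleftrightarrow>
     (\<forall>x. X x 0 = x) \<and>
     (\<forall>x. cadlag (X x)) \<and>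
     (\<forall>x y s t. s \<ge> 0 \<longrightarrow> t \<ge> 0 \<longrightarrow> X x s = X y t \<longrightarrow> (\<forall>h\<ge>0. X x (s + h) = X y (t + h)))"

text \<open>Quasi-left continuity asks that \<open>X\<close> at \<open>\<tau> n\<close> converges to \<open>X\<close> at \<open>\<sigma>\<close> almost surely on
  \<open>{\<sigma> < \<infinity>}\<close> whenever \<open>\<tau> n\<close> are stopping times increasing to \<open>\<sigma>\<close>. A path that does not depend on
  \<open>\<omega>\<close> generates the trivial filtration, so the stopping times are the constants in \<open>[0,\<infinity>]\<close>, and
  those bounded by a finite \<open>\<sigma>\<close> are nonnegative reals.\<close>

definition quasi_left_continuous :: "(real \<Rightarrow> real) \<Rightarrow> bool" where
  "quasi_left_continuous f \<longleftrightarrow>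
     (\<forall>\<tau> \<sigma>. (\<forall>n::nat. \<tau> n \<ge> 0) \<longrightarrow> incseq \<tau> \<longrightarrow> \<tau> \<longlonglongrightarrow> \<sigma> \<longrightarrow> (\<lambda>n. f (\<tau> n)) \<longlonglongrightarrow> f \<sigma>)"

definition deterministic_hunt :: "(real \<Rightarrow> real \<Rightarrow> real) \<Rightarrow> bool" where
  "deterministic_hunt X \<longleftrightarrow> deterministic_markov X \<and> (\<forall>x. quasi_left_continuous (X x))"

definition C_infty :: "(real \<Rightarrow> real) set" where
  "C_infty = {u. continuous_on UNIV u \<and> (u \<longlongrightarrow> 0) at_infinity}"

text \<open>The expectation of \<open>u (X\<^sub>t)\<close> under the starting point \<open>x\<close> is the value itself, since the paths
  are not random.\<close>

definition transition_semigroup :: "(real \<Rightarrow> real \<Rightarrow> real) \<Rightarrow> real \<Rightarrow> (real \<Rightarrow> real) \<Rightarrow> real \<Rightarrow> real" where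
  "transition_semigroup X t u = (\<lambda>x. u (X x t))"

text \<open>Only applied to bounded functions, for which the real supremum is the genuine one.\<close>

definition sup_norm :: "(real \<Rightarrow> real) \<Rightarrow> real" where
  "sup_norm u = (SUP x. \<bar>u x\<bar>)"

definition deterministic_feller :: "(real \<Rightarrow> real \<Rightarrow> real) \<Rightarrow> bool" where
  "deterministic_feller X \<longleftrightarrow>
     deterministic_markov X \<and>
     (\<forall>t\<ge>0. \<forall>u\<in>C_infty. transition_semigroup X t u \<in> C_infty) \<and>
     (\<forall>u\<in>C_infty. ((\<lambda>t. sup_norm (\<lambda>x. transition_semigroup X t u x - u x)) \<longlongrightarrow> 0) (at_right 0))"

definition hunt_expandable :: "(real \<Rightarrow> real) \<Rightarrow> bool" where
  "hunt_expandable f \<longleftrightarrow> (\<exists>X. deterministic_hunt X \<and> (\<forall>t\<ge>0. X (f 0) t = f t))"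

definition feller_expandable :: "(real \<Rightarrow> real) \<Rightarrow> bool" where
  "feller_expandable f \<longleftrightarrow> (\<exists>X. deterministic_feller X \<and> (\<forall>t\<ge>0. X (f 0) t = f t))"

end

theory Submission
  imports Defs
begin

text \<open>For a Feller process, \<open>\<bar>u (X\<^sub>t) - u (X\<^sub>s)\<bar> \<le> \<parallel>T\<^bsub>t-s\<^esub> u - u\<parallel>\<close> for \<open>s \<le> t\<close>, so the paths are left
  continuous. Conversely, a path of a Hunt process is continuous and its position determines its
  future. If it visits a point twice, it is periodic from then on; the intermediate value theorem
  makes half of any period a period again, so the path is constant from then on. Hence the path is
  monotone, say increasing. Prolonging it to negative times with unit slope gives an increasing
  \<open>g\<close> on \<open>\<real>\<close>, and letting \<open>g r\<close> move to \<open>g (r + t)\<close> while the points outside the range of \<open>g\<close> stay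
  put is a Feller process: each time-\<open>t\<close> map is an increasing surjection, and strong continuity is
  the uniform continuity of \<open>u \<circ> g\<close>, which has limits at \<open>\<plusminus>\<infinity>\<close>.\<close>

section \<open>Feller processes are Hunt processes\<close>

lemma C_infty_bounded:
  assumes "u \<in> C_infty"
  shows "\<exists>B. \<forall>x. \<bar>u x\<bar> \<le> B"
proof -
  have cont: "continuous_on UNIV u" and lim: "(u \<longlongrightarrow> 0) at_infinity"
    using assms by (auto simp: C_infty_def)
  from tendstoD[OF lim zero_less_one] obtain b where b: "\<And>x. norm x \<ge> b \<Longrightarrow> \<bar>u x\<bar> < 1"
    by (auto simp: eventually_at_infinity)
  have "compact (u ` {-b..b})"
    by (intro compact_continuous_image continuous_on_subset[OF cont]) auto
  then obtain B where B: "\<And>x. x \<in> {-b..b} \<Longrightarrow> \<bar>u x\<bar> \<le> B"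
    by (meson bounded_real compact_imp_bounded imageI)
  have "\<bar>u x\<bar> \<le> max 1 B" for x
  proof (cases "\<bar>x\<bar> \<ge> b")
    case True
    then show ?thesis using b[of x] by simp
  next
    case False
    then have "x \<in> {-b..b}" by auto
    then show ?thesis using B by (simp add: le_max_iff_disj)
  qed
  then show ?thesis by blast
qed

lemma abs_le_sup_norm:
  assumes "\<And>x. \<bar>v x\<bar> \<le> B"
  shows "\<bar>v x\<bar> \<le> sup_norm v"
  unfolding sup_norm_def using assms by (intro cSUP_upper bdd_aboveI) auto

lemma sup_norm_le:
  assumes "\<And>x. \<bar>v x\<bar> \<le> B"
  shows "sup_norm v \<le> B"
  unfolding sup_norm_def using assms by (intro cSUP_least) auto

lemma sup_norm_nonneg:
  assumes "\<And>x. \<bar>v x\<bar> \<le> B"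
  shows "0 \<le> sup_norm v"
  using abs_le_sup_norm[of v B 0] assms by fastforce

text \<open>A single test function that detects convergence to \<open>z\<close>: it takes its
  maximum 1 exactly at \<open>z\<close>, and values near 1 force points near
  \<open>z\<close>.\<close>

lemma inverse_distance_in_C_infty: "(\<lambda>y. 1 / (1 + \<bar>y - z\<bar>)) \<in> C_infty" for z :: real
proof -
  have "continuous_on UNIV (\<lambda>y. 1 / (1 + \<bar>y - z\<bar>))"
    by (intro continuous_intros) (simp add: add_pos_nonneg less_imp_neq[symmetric])
  moreover have "((\<lambda>y. 1 / (1 + \<bar>y - z\<bar>)) \<longlongrightarrow> 0) at_infinity"
  proof (rule tendstoI)
    fix e :: real assume "e > 0"
    have "dist (1 / (1 + \<bar>y - z\<bar>)) 0 < e" if "norm y \<ge> \<bar>z\<bar> + 1 / e" for y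
    proof -
      have *: "1 + \<bar>y - z\<bar> > 1 / e" using that by auto
      then have "1 / (1 + \<bar>y - z\<bar>) < e" using \<open>e > 0\<close> by (simp add: field_simps)
      then show ?thesis by simp
    qed
    then show "\<forall>\<^sub>F y in at_infinity. dist (1 / (1 + \<bar>y - z\<bar>)) 0 < e"
      unfolding eventually_at_infinity by blast
  qed
  ultimately show ?thesis by (simp add: C_infty_def)
qed

text \<open>The distance is recovered from the value of the test function as 1 / value - 1, which is
  continuous at the value 1.\<close>

lemma tendsto_of_inverse_distance:
  fixes y :: "'a \<Rightarrow> real"
  assumes "((\<lambda>n. 1 / (1 + \<bar>y n - z\<bar>)) \<longlongrightarrow> 1) F"
  shows "(y \<longlongrightarrow> z) F"
proof -
  have "((\<lambda>n. 1 / (1 / (1 + \<bar>y n - z\<bar>)) - 1) \<longlongrightarrow> 1 / 1 - 1) F"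
    by (intro tendsto_intros assms) auto
  then have "((\<lambda>n. \<bar>y n - z\<bar>) \<longlongrightarrow> 0) F" by simp
  then show ?thesis
    by (simp add: tendsto_rabs_zero_iff LIM_zero_iff)
qed

lemma feller_imp_hunt:
  assumes "deterministic_feller X"
  shows "deterministic_hunt X"
proof -
  have markov: "deterministic_markov X"
    and strong: "\<And>u. u \<in> C_infty \<Longrightarrow>
      ((\<lambda>t. sup_norm (\<lambda>x. transition_semigroup X t u x - u x)) \<longlongrightarrow> 0) (at_right 0)"
    using assms by (auto simp: deterministic_feller_def)
  have restart: "X (X x s) h = X x (s + h)" if "s \<ge> 0" "h \<ge> 0" for x s h
  proof -
    have "X (X x s) 0 = X x s" using markov by (simp add: deterministic_markov_def)
    then have "X (X x s) (0 + h) = X x (s + h)"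
      using markov that unfolding deterministic_markov_def by (metis order_refl)
    then show ?thesis by simp
  qed
  have "quasi_left_continuous (X x)" for x
    unfolding quasi_left_continuous_def
  proof (intro allI impI)
    fix \<tau> :: "nat \<Rightarrow> real" and \<sigma>
    assume nonneg: "\<forall>n. \<tau> n \<ge> 0" and inc: "incseq \<tau>" and lim: "\<tau> \<longlonglongrightarrow> \<sigma>"
    have le: "\<tau> n \<le> \<sigma>" for n by (rule incseq_le[OF inc lim])
    \<comment> \<open>The test function is centred at the target state, so that convergence of
      \<open>u\<close> along the path is convergence of the path itself.\<close>
    define u where "u = (\<lambda>y. 1 / (1 + \<bar>y - X x \<sigma>\<bar>))"
    have u: "u \<in> C_infty" unfolding u_def by (rule inverse_distance_in_C_infty)
    then obtain B where B: "\<And>y. \<bar>u y\<bar> \<le> B" using C_infty_bounded by blast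
    let ?N = "\<lambda>t. sup_norm (\<lambda>y. transition_semigroup X t u y - u y)"
    have step: "\<bar>u (X x \<sigma>) - u (X x (\<tau> n))\<bar> \<le> ?N (\<sigma> - \<tau> n)" for n
    proof -
      have "\<bar>transition_semigroup X (\<sigma> - \<tau> n) u y - u y\<bar> \<le> 2 * B" for y
        using B[of y] B[of "X y (\<sigma> - \<tau> n)"] by (simp add: transition_semigroup_def)
      then have "\<bar>transition_semigroup X (\<sigma> - \<tau> n) u (X x (\<tau> n)) - u (X x (\<tau> n))\<bar> \<le> ?N (\<sigma> - \<tau> n)"
        by (rule abs_le_sup_norm)
      then show ?thesis
        using restart[of "\<tau> n" "\<sigma> - \<tau> n" x] nonneg le[of n] by (simp add: transition_semigroup_def)
    qed
    have "(\<lambda>n. u (X x (\<tau> n))) \<longlonglongrightarrow> u (X x \<sigma>)"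
    proof (rule tendstoI)
      fix e :: real assume "e > 0"
      from tendstoD[OF strong[OF u] this] obtain d where "d > 0"
        and d: "\<And>t. 0 < t \<Longrightarrow> t < d \<Longrightarrow> \<bar>?N t\<bar> < e"
        by (auto simp: eventually_at_right_field)
      have "\<forall>\<^sub>F n in sequentially. dist (\<tau> n) \<sigma> < d" by (rule tendstoD[OF lim \<open>d > 0\<close>])
      then show "\<forall>\<^sub>F n in sequentially. dist (u (X x (\<tau> n))) (u (X x \<sigma>)) < e"
      proof eventually_elim
        case (elim n)
        \<comment> \<open>The limit at \<open>at_right 0\<close> says nothing about the time
          increment 0, so indices where the sequence has already reached its limit are
          separated.\<close>
        show ?case
        proof (cases "\<tau> n = \<sigma>")
          case False
          then have "\<bar>?N (\<sigma> - \<tau> n)\<bar> < e"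
            using le[of n] elim by (intro d) (auto simp: dist_real_def)
          then show ?thesis using step[of n] by (simp add: dist_real_def)
        qed (use \<open>e > 0\<close> in auto)
      qed
    qed
    then have "(\<lambda>n. 1 / (1 + \<bar>X x (\<tau> n) - X x \<sigma>\<bar>)) \<longlonglongrightarrow> 1"
      by (simp add: u_def)
    then show "(\<lambda>n. X x (\<tau> n)) \<longlonglongrightarrow> X x \<sigma>"
      by (rule tendsto_of_inverse_distance)
  qed
  then show ?thesis using markov by (simp add: deterministic_hunt_def)
qed

section \<open>Monotonicity of the paths of a Hunt process\<close>

text \<open>The left limit exists by the cadlag property, so one sequence approaching
  \<open>t\<close> strictly from the left suffices to identify it as \<open>p t\<close>.\<close>

lemma quasi_left_continuous_imp_continuous:
  assumes "cadlag p" "quasi_left_continuous p"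
  shows "continuous_on {0..} p"
  unfolding continuous_on_def
proof
  fix t :: real assume "t \<in> {0..}"
  have right: "(p \<longlongrightarrow> p t) (at_right t)"
    using assms(1) \<open>t \<in> {0..}\<close> by (auto simp: cadlag_def)
  show "(p \<longlongrightarrow> p t) (at t within {0..})"
  proof (cases "t = 0")
    case True
    with right show ?thesis by (simp add: at_within_Ici_at_right)
  next
    case False
    with \<open>t \<in> {0..}\<close> have "t > 0" by auto
    then obtain l where l: "(p \<longlongrightarrow> l) (at_left t)"
      using assms(1) by (auto simp: cadlag_def)
    \<comment> \<open>This sequence starts at 0, as nonnegative times are required, and never
      reaches \<open>t\<close>, so it converges within \<open>at_left t\<close>.\<close>
    define \<tau> where "\<tau> = (\<lambda>n. t - t / real (Suc n))"
    have inc: "incseq \<tau>"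
      unfolding \<tau>_def using \<open>t > 0\<close> by (intro incseq_SucI) (simp add: field_simps)
    have nonneg: "\<tau> n \<ge> 0" for n
      using \<open>t > 0\<close> by (simp add: \<tau>_def field_simps)
    have "(\<lambda>n. t - t * inverse (real (Suc n))) \<longlonglongrightarrow> t - t * 0"
      by (intro tendsto_intros LIMSEQ_inverse_real_of_nat)
    then have lim: "\<tau> \<longlonglongrightarrow> t" by (simp add: \<tau>_def field_simps)
    have "filterlim \<tau> (at_left t) sequentially"
      using lim \<open>t > 0\<close> by (auto simp: filterlim_at \<tau>_def)
    then have "(\<lambda>n. p (\<tau> n)) \<longlonglongrightarrow> l" by (rule filterlim_compose[OF l])
    moreover have "(\<lambda>n. p (\<tau> n)) \<longlonglongrightarrow> p t"
      using assms(2) nonneg inc lim unfolding quasi_left_continuous_def by blast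
    ultimately have "l = p t" by (rule LIMSEQ_unique)
    with l right have "(p \<longlongrightarrow> p t) (at t)" by (simp add: filterlim_at_split)
    then show ?thesis by (rule filterlim_mono) (auto simp: at_le)
  qed
qed

text \<open>The Markov condition for one path compared with itself. Together with continuity it is
  all that the converse direction keeps of the Hunt process.\<close>

definition state_determined :: "(real \<Rightarrow> real) \<Rightarrow> bool" where
  "state_determined p \<longleftrightarrow>
     (\<forall>a\<ge>0. \<forall>b\<ge>0. p a = p b \<longrightarrow> (\<forall>h\<ge>0. p (a + h) = p (b + h)))"

lemma state_determinedD:
  "state_determined p \<Longrightarrow> p a = p b \<Longrightarrow> a \<ge> 0 \<Longrightarrow> b \<ge> 0 \<Longrightarrow> h \<ge> 0 \<Longrightarrow> p (a + h) = p (b + h)"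
  unfolding state_determined_def by blast

lemma half_period:
  fixes p :: "real \<Rightarrow> real"
  assumes cont: "continuous_on {0..} p" and det: "state_determined p"
    and "s \<ge> 0" "c > 0" and per: "\<And>x. x \<ge> s \<Longrightarrow> p (x + c) = p x" and "x \<ge> s"
  shows "p (x + c / 2) = p x"
proof -
  define d where "d = (\<lambda>x. p (x + c / 2) - p x)"
  have "continuous_on {s..s + c / 2} d" unfolding d_def
    using \<open>s \<ge> 0\<close> \<open>c > 0\<close>
    by (intro continuous_intros continuous_on_compose2[OF cont] continuous_on_subset[OF cont]) auto
  \<comment> \<open>Shifting by half a period swaps the two terms of \<open>d\<close>, so
    \<open>d\<close> changes sign and vanishes somewhere in between.\<close>
  moreover have "d (s + c / 2) = - d s" using per[of s] by (simp add: d_def add.assoc)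
  ultimately obtain z where z: "z \<ge> s" "z \<le> s + c / 2" "d z = 0"
    using IVT'[of d s 0 "s + c / 2"] IVT2'[of d "s + c / 2" 0 s] \<open>c > 0\<close>
    by (cases "d s \<le> 0") auto
  \<comment> \<open>The coincidence at \<open>z\<close> only propagates forward and \<open>x\<close>
    may precede \<open>z\<close>; it is therefore carried to \<open>x + c\<close>, which lies beyond
    \<open>z\<close>, and pulled back by the period \<open>c\<close>.\<close>
  then have "p (z + c / 2 + (x + c - z)) = p (z + (x + c - z))"
    using \<open>s \<ge> 0\<close> \<open>c > 0\<close> \<open>x \<ge> s\<close> by (intro state_determinedD[OF det]) (auto simp: d_def)
  then have "p ((x + c / 2) + c) = p (x + c)" by (simp add: algebra_simps)
  then show ?thesis using per[of "x + c / 2"] per[of x] \<open>x \<ge> s\<close> \<open>c > 0\<close> by simp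
qed

text \<open>Repeated halving yields arbitrarily small periods. Reducing \<open>x\<close> modulo them
  gives times tending to \<open>s\<close> at which the path still has the value \<open>p x\<close>,
  and continuity at \<open>s\<close> concludes.\<close>

lemma constant_after_revisit:
  fixes p :: "real \<Rightarrow> real"
  assumes cont: "continuous_on {0..} p" and det: "state_determined p"
    and "0 \<le> s" "s < t" "p s = p t" "x \<ge> s"
  shows "p x = p s"
proof -
  define c where "c = (\<lambda>n::nat. (t - s) / 2 ^ n)"
  have cpos: "c n > 0" for n using \<open>s < t\<close> by (simp add: c_def)
  have per: "p (y + c n) = p y" if "y \<ge> s" for n y
    using that
  proof (induction n arbitrary: y)
    case 0
    have "p (s + (y - s)) = p (t + (y - s))"
      using assms 0 by (intro state_determinedD[OF det]) auto
    then show ?case by (simp add: c_def algebra_simps)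
  next
    case (Suc n)
    have half: "c (Suc n) = c n / 2" by (simp add: c_def)
    show ?case unfolding half
      using half_period[of p s "c n" y] Suc.IH Suc.prems cont det \<open>0 \<le> s\<close> cpos[of n] by simp
  qed
  have iter: "p (y + real k * c n) = p y" if "y \<ge> s" for n k y
  proof (induction k)
    case (Suc k)
    have "p ((y + real k * c n) + c n) = p (y + real k * c n)"
      using that cpos[of n] by (intro per) (simp add: add_increasing2)
    with Suc show ?case by (simp add: algebra_simps)
  qed simp
  \<comment> \<open>The remainder of \<open>x - s\<close> modulo \<open>c n\<close>.\<close>
  define r where "r = (\<lambda>n. frac ((x - s) / c n) * c n)"
  have r: "0 \<le> r n" "r n \<le> c n" for n
    using cpos[of n] by (auto simp: r_def frac_lt_1 less_imp_le mult_left_le_one_le)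
  have pr: "p (s + r n) = p x" for n
  proof -
    have "real (nat \<lfloor>(x - s) / c n\<rfloor>) = (x - s) / c n - frac ((x - s) / c n)"
      using \<open>x \<ge> s\<close> cpos[of n] by (simp add: frac_def)
    moreover have "(x - s) / c n * c n = x - s" using cpos[of n] by simp
    ultimately have "real (nat \<lfloor>(x - s) / c n\<rfloor>) * c n = x - s - r n"
      by (simp only: r_def left_diff_distrib)
    then show ?thesis using iter[of "s + r n" "nat \<lfloor>(x - s) / c n\<rfloor>" n] r(1)[of n] by simp
  qed
  have "(\<lambda>n. (t - s) * (1 / 2) ^ n) \<longlonglongrightarrow> (t - s) * 0"
    by (intro tendsto_intros LIMSEQ_realpow_zero) auto
  then have "c \<longlonglongrightarrow> 0" by (simp add: c_def power_divide)
  then have "r \<longlonglongrightarrow> 0"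
    using tendsto_sandwich[of "\<lambda>_. 0" r sequentially c 0] r by simp
  then have "(\<lambda>n. s + r n) \<longlonglongrightarrow> s + 0" by (intro tendsto_intros)
  then have "(\<lambda>n. p (s + r n)) \<longlonglongrightarrow> p s"
    using \<open>0 \<le> s\<close> r by (intro continuous_on_tendsto_compose[OF cont]) auto
  then show ?thesis by (simp add: pr LIMSEQ_const_iff)
qed

text \<open>An excursion above both ends would cross the level of the higher end before and after
  \<open>b\<close>; this revisit freezes the path at that level, so it could not reach
  \<open>p b\<close>.\<close>

lemma le_max_ends:
  fixes p :: "real \<Rightarrow> real"
  assumes cont: "continuous_on {0..} p" and det: "state_determined p"
    and "0 \<le> a" "a \<le> b" "b \<le> c"
  shows "p b \<le> max (p a) (p c)"
proof (rule ccontr)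
  define v where "v = max (p a) (p c)"
  assume "\<not> p b \<le> max (p a) (p c)"
  then have v: "v < p b" "p a \<le> v" "p c \<le> v" by (auto simp: v_def)
  obtain s where s: "a \<le> s" "s \<le> b" "p s = v"
    using IVT'[of p a v b] v assms continuous_on_subset[OF cont, of "{a..b}"] by auto
  obtain t where t: "b \<le> t" "t \<le> c" "p t = v"
    using IVT2'[of p c v b] v assms continuous_on_subset[OF cont, of "{b..c}"] by auto
  have "s \<noteq> b" using s v by auto
  then have "p b = p s"
    using constant_after_revisit[OF cont det, of s t b] s t assms by auto
  with s v show False by simp
qed

lemma state_determined_minus: "state_determined p \<Longrightarrow> state_determined (\<lambda>t. - p t)"
  unfolding state_determined_def neg_equal_iff_equal .

lemma mono_if_above_start:
  assumes "continuous_on {0..} p" "state_determined p" "0 \<le> c" "p 0 < p c"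
  shows "mono_on {0..} p"
proof (rule mono_onI)
  have min: "min (p a) (p c) \<le> p b" if "0 \<le> a" "a \<le> b" "b \<le> c" for a b c
    using le_max_ends[of "\<lambda>t. - p t" a b c] assms that
    by (auto simp: continuous_on_minus state_determined_minus)
  \<comment> \<open>Before \<open>c\<close> the lower bound \<open>min\<close> applies. After
    \<open>c\<close>, the value \<open>p c\<close> is at most the larger end value, which cannot be
    \<open>p 0\<close>, so \<open>p y\<close> is at least \<open>p c\<close>.\<close>
  have above: "p 0 \<le> p y" if "0 \<le> y" for y
  proof (cases "y \<le> c")
    case True
    then show ?thesis using min[of 0 y c] assms that by auto
  next
    case False
    then show ?thesis using le_max_ends[of p 0 c y] assms by auto
  qed
  fix x y :: real assume "x \<in> {0..}" "y \<in> {0..}" "x \<le> y"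
  then show "p x \<le> p y" using le_max_ends[of p 0 x y] above[of y] assms by auto
qed

lemma state_determined_monotone:
  assumes cont: "continuous_on {0..} p" and det: "state_determined p"
  shows "mono_on {0..} p \<or> mono_on {0..} (\<lambda>t. - p t)"
proof (cases "\<exists>c\<ge>0. p 0 \<noteq> p c")
  case True
  then show ?thesis
    using mono_if_above_start[of p] mono_if_above_start[of "\<lambda>t. - p t"] cont det
    by (auto simp: continuous_on_minus state_determined_minus neq_iff)
next
  case False
  then have "p x = p 0" if "x \<ge> 0" for x using that by metis
  then have "mono_on {0..} p" by (intro mono_onI) (metis atLeast_iff order_refl)
  then show ?thesis by simp
qed

section \<open>The Feller process of an increasing orbit\<close>

lemma continuous_imp_cadlag: "continuous_on UNIV p \<Longrightarrow> cadlag p"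
  unfolding cadlag_def continuous_on_def
  by (meson UNIV_I filterlim_at_split)

lemma filterlim_mono_surj:
  fixes m :: "real \<Rightarrow> real"
  assumes "mono m" "surj m"
  shows "filterlim m at_top at_top" "filterlim m at_bot at_bot"
proof -
  show "filterlim m at_top at_top"
    unfolding filterlim_at_top eventually_at_top_linorder
    using assms by (metis monoD surjD)
  show "filterlim m at_bot at_bot"
    unfolding filterlim_at_bot eventually_at_bot_linorder
    using assms by (metis monoD surjD)
qed

lemma C_inftyD:
  assumes "u \<in> C_infty"
  shows "continuous_on UNIV u" "(u \<longlongrightarrow> 0) at_top" "(u \<longlongrightarrow> 0) at_bot"
  using assms
  by (auto simp: C_infty_def
      intro: tendsto_mono[OF at_top_le_at_infinity] tendsto_mono[OF at_bot_le_at_infinity])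

text \<open>A monotone surjection has no jumps, hence is continuous, and it preserves both infinite
  ends. This reduces (F1) to order and surjectivity of the time-t maps.\<close>

lemma C_infty_compose_mono_surj:
  assumes "u \<in> C_infty" "mono m" "surj m"
  shows "(\<lambda>x. u (m x)) \<in> C_infty"
proof -
  note u = C_inftyD[OF assms(1)]
  have "continuous_on UNIV m"
    using assms(2,3) by (intro continuous_onI_mono) (auto simp: mono_def)
  moreover have "((\<lambda>x. u (m x)) \<longlongrightarrow> 0) at_top" "((\<lambda>x. u (m x)) \<longlongrightarrow> 0) at_bot"
    using filterlim_mono_surj[OF assms(2,3)] filterlim_compose u(2,3) by blast+
  ultimately show ?thesis
    using continuous_on_compose2[OF u(1)]
    by (simp add: C_infty_def at_infinity_eq_at_top_bot filterlim_sup)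
qed

lemma uniformly_continuous_on_real_line:
  fixes v :: "real \<Rightarrow> real"
  assumes cont: "continuous_on UNIV v" and bot: "(v \<longlongrightarrow> k) at_bot" and top: "(v \<longlongrightarrow> l) at_top"
  shows "uniformly_continuous_on UNIV v"
  unfolding uniformly_continuous_on_def
proof (intro allI impI)
  fix e :: real assume "e > 0"
  then have "e / 2 > 0" by simp
  obtain A where A: "\<And>x. x \<le> A \<Longrightarrow> dist (v x) k < e / 2"
    using tendstoD[OF bot \<open>e / 2 > 0\<close>] by (auto simp: eventually_at_bot_linorder)
  obtain B where B: "\<And>x. x \<ge> B \<Longrightarrow> dist (v x) l < e / 2"
    using tendstoD[OF top \<open>e / 2 > 0\<close>] by (auto simp: eventually_at_top_linorder)
  have "uniformly_continuous_on {A - 1..B + 1} v"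
    by (intro compact_uniformly_continuous continuous_on_subset[OF cont]) auto
  then obtain d where "d > 0"
    and d: "\<And>x y. x \<in> {A - 1..B + 1} \<Longrightarrow> y \<in> {A - 1..B + 1} \<Longrightarrow> dist y x < d \<Longrightarrow> dist (v y) (v x) < e"
    unfolding uniformly_continuous_on_def using \<open>e > 0\<close> by metis
  have "dist (v y) (v x) < e" if xy: "dist y x < min d 1" for x y
  proof -
    \<comment> \<open>Points less than 1 apart that share neither tail lie in the compact interval,
      because it was widened by 1 on each side.\<close>
    consider "x \<le> A \<and> y \<le> A" | "x \<ge> B \<and> y \<ge> B" | "x \<in> {A - 1..B + 1} \<and> y \<in> {A - 1..B + 1}"
      using xy by (force simp: dist_real_def)
    then show ?thesis
    proof cases
      case 1
      then show ?thesis using A dist_triangle_half_l by blast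
    next
      case 2
      then show ?thesis using B dist_triangle_half_l by blast
    next
      case 3
      then show ?thesis using d xy by auto
    qed
  qed
  then show "\<exists>d>0. \<forall>x\<in>UNIV. \<forall>y\<in>UNIV. dist y x < d \<longrightarrow> dist (v y) (v x) < e"
    using \<open>d > 0\<close> by (intro exI[of _ "min d 1"]) auto
qed

text \<open>Ensures that \<open>u\<close> composed with \<open>g\<close> has a limit at the upper
  end in both cases: 0 if \<open>g\<close> is unbounded above, the value of \<open>u\<close> at the
  supremum otherwise.\<close>

lemma mono_real_at_top_cases:
  fixes g :: "real \<Rightarrow> real"
  assumes "mono g"
  shows "filterlim g at_top at_top \<or> (\<exists>l. (g \<longlongrightarrow> l) at_top)"
proof (cases "bdd_above (range g)")
  case True
  have "(g \<longlongrightarrow> (SUP x. g x)) at_top"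
  proof (rule order_tendstoI)
    fix a assume "a < (SUP x. g x)"
    then obtain x where "a < g x" using True by (auto simp: less_cSUP_iff)
    then show "\<forall>\<^sub>F x in at_top. a < g x"
      unfolding eventually_at_top_linorder using assms by (metis monoD less_le_trans)
  next
    fix a assume "(SUP x. g x) < a"
    then show "\<forall>\<^sub>F x in at_top. g x < a"
      using True by (intro always_eventually allI) (meson UNIV_I cSUP_upper le_less_trans)
  qed
  then show ?thesis by blast
next
  case False
  have "\<exists>x. \<forall>y\<ge>x. Z \<le> g y" for Z
  proof -
    obtain x where "Z \<le> g x"
      using False by (metis bdd_aboveI2 linear)
    then show ?thesis using assms by (metis monoD order_trans)
  qed
  then show ?thesis by (simp add: filterlim_at_top eventually_at_top_linorder)
qed

section \<open>The flow along an increasing orbit\<close>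

definition orbit_flow :: "(real \<Rightarrow> real) \<Rightarrow> real \<Rightarrow> real \<Rightarrow> real" where
  "orbit_flow g x t = (if x \<in> range g then g (inv g x + t) else x)"

locale increasing_orbit =
  fixes g :: "real \<Rightarrow> real"
  assumes cont: "continuous_on UNIV g"
    and mono: "mono g"
    and at_bot: "filterlim g at_bot at_bot"
    and determined: "g a = g b \<Longrightarrow> 0 \<le> h \<Longrightarrow> g (a + h) = g (b + h)"
begin

text \<open>\<open>inv g (g r)\<close> may differ from \<open>r\<close> when \<open>g\<close> is not
  injective; \<open>determined\<close> makes the choice of preimage irrelevant for forward
  times.\<close>

lemma flow_on_orbit: "0 \<le> t \<Longrightarrow> orbit_flow g (g r) t = g (r + t)"
  using determined[of "inv g (g r)" r t] by (simp add: orbit_flow_def f_inv_into_f)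

lemma flow_off_orbit: "x \<notin> range g \<Longrightarrow> orbit_flow g x t = x"
  by (simp add: orbit_flow_def)

lemma flow_in_range_iff: "orbit_flow g x t \<in> range g \<longleftrightarrow> x \<in> range g"
  by (simp add: orbit_flow_def)

text \<open>By the intermediate value theorem, since \<open>g\<close> comes from minus infinity.
  Hence every point off the orbit lies above the whole orbit, which is what keeps the flow
  monotone.\<close>

lemma range_downward_closed:
  assumes "x \<le> g r"
  shows "x \<in> range g"
proof -
  obtain a where a: "\<And>y. y \<le> a \<Longrightarrow> g y \<le> x"
    using at_bot unfolding filterlim_at_bot eventually_at_bot_linorder by blast
  then show ?thesis
    using IVT'[of g "min a r" x r] assms continuous_on_subset[OF cont] by fastforce
qed

lemma flow_markov: "deterministic_markov (orbit_flow g)"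
  unfolding deterministic_markov_def
proof (intro conjI allI impI)
  fix x
  show "orbit_flow g x 0 = x" by (simp add: orbit_flow_def f_inv_into_f)
  have "continuous_on UNIV (orbit_flow g x)"
  proof (cases "x \<in> range g")
    case True
    then have "orbit_flow g x = (\<lambda>t. g (inv g x + t))" by (auto simp: orbit_flow_def)
    then show ?thesis by (auto intro!: continuous_intros continuous_on_compose2[OF cont])
  next
    case False
    then have "orbit_flow g x = (\<lambda>t. x)" by (auto simp: orbit_flow_def)
    then show ?thesis by simp
  qed
  then show "cadlag (orbit_flow g x)" by (rule continuous_imp_cadlag)
next
  fix x y s t h :: real
  assume *: "s \<ge> 0" "t \<ge> 0" "orbit_flow g x s = orbit_flow g y t" "h \<ge> 0"
  show "orbit_flow g x (s + h) = orbit_flow g y (t + h)"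
  proof (cases "x \<in> range g \<and> y \<in> range g")
    case True
    then obtain a b where "x = g a" "y = g b" by blast
    then show ?thesis
      using * determined[of "a + s" "b + t" h] by (simp add: flow_on_orbit add.assoc)
  next
    case False
    \<comment> \<open>The orbit and its complement are both invariant, so a moving and a resting
      point never meet.\<close>
    then have "x \<notin> range g" "y \<notin> range g" using *(3) flow_in_range_iff by metis+
    then show ?thesis using * by (simp add: flow_off_orbit)
  qed
qed

lemma flow_mono:
  assumes "t \<ge> 0"
  shows "mono (\<lambda>x. orbit_flow g x t)"
proof (rule monoI)
  fix x y :: real assume "x \<le> y"
  show "orbit_flow g x t \<le> orbit_flow g y t"
  proof (cases "y \<in> range g")
    case True
    then obtain b where b: "y = g b" by blast
    then obtain a where a: "x = g a" using range_downward_closed \<open>x \<le> y\<close> by blast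
    show ?thesis
    proof (cases "a \<le> b")
      case True
      then show ?thesis using a b assms mono by (simp add: flow_on_orbit monoD)
    next
      case False
      \<comment> \<open>Parameters in the opposite order to the points are possible only where
        \<open>g\<close> is constant between them.\<close>
      then have "x = y" using \<open>x \<le> y\<close> a b monoD[OF mono, of b a] by simp
      then show ?thesis by simp
    qed
  next
    case False
    have "orbit_flow g x t \<le> y"
    proof (cases "x \<in> range g")
      case True
      then obtain b where "orbit_flow g x t = g b" using flow_in_range_iff[of x t] by blast
      then show ?thesis using range_downward_closed[of y b] False by force
    qed (use \<open>x \<le> y\<close> in \<open>simp add: flow_off_orbit\<close>)
    then show ?thesis using False by (simp add: flow_off_orbit)
  qed
qed

text \<open>The preimage of \<open>g r\<close> is \<open>g (r - t)\<close>; this is where the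
  prolongation of the orbit to all negative times matters.\<close>

lemma flow_surj:
  assumes "t \<ge> 0"
  shows "surj (\<lambda>x. orbit_flow g x t)"
proof (rule surjI)
  fix y
  show "orbit_flow g (if y \<in> range g then g (inv g y - t) else y) t = y"
    by (cases "y \<in> range g")
      (simp_all add: flow_on_orbit[OF assms] flow_off_orbit f_inv_into_f del: rangeI)
qed

lemma uniformly_continuous_along_orbit:
  assumes "u \<in> C_infty"
  shows "uniformly_continuous_on UNIV (\<lambda>r. u (g r))"
proof -
  note u = C_inftyD[OF assms]
  have "\<exists>l. ((\<lambda>r. u (g r)) \<longlongrightarrow> l) at_top"
    using mono_real_at_top_cases[OF mono]
  proof
    assume "filterlim g at_top at_top"
    then show ?thesis using filterlim_compose[OF u(2)] by blast
  next
    assume "\<exists>l. (g \<longlongrightarrow> l) at_top"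
    then obtain l where "(g \<longlongrightarrow> l) at_top" by blast
    then have "((\<lambda>r. u (g r)) \<longlongrightarrow> u l) at_top"
      by (intro continuous_on_tendsto_compose[OF u(1)]) auto
    then show ?thesis by blast
  qed
  moreover have "((\<lambda>r. u (g r)) \<longlongrightarrow> 0) at_bot" by (rule filterlim_compose[OF u(3) at_bot])
  ultimately show ?thesis
    using uniformly_continuous_on_real_line continuous_on_compose2[OF u(1) cont] by blast
qed

lemma flow_feller: "deterministic_feller (orbit_flow g)"
  unfolding deterministic_feller_def
proof (intro conjI ballI allI impI)
  show "deterministic_markov (orbit_flow g)" by (rule flow_markov)
next
  fix t :: real and u assume "0 \<le> t" "u \<in> C_infty"
  then show "transition_semigroup (orbit_flow g) t u \<in> C_infty"
    unfolding transition_semigroup_def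
    using C_infty_compose_mono_surj flow_mono flow_surj by blast
next
  fix u assume u: "u \<in> C_infty"
  show "((\<lambda>t. sup_norm (\<lambda>x. transition_semigroup (orbit_flow g) t u x - u x)) \<longlongrightarrow> 0) (at_right 0)"
  proof (rule tendstoI)
    fix e :: real assume "e > 0"
    \<comment> \<open>Passing to the supremum turns a strict bound into a weak one, hence the margin
      \<open>e / 2\<close>.\<close>
    then have "e / 2 > 0" by simp
    then obtain d where "d > 0" and d: "\<And>x y. dist y x < d \<Longrightarrow> dist (u (g y)) (u (g x)) < e / 2"
      using uniformly_continuous_along_orbit[OF u] unfolding uniformly_continuous_on_def
      by (metis UNIV_I)
    have "dist (sup_norm (\<lambda>x. transition_semigroup (orbit_flow g) t u x - u x)) 0 < e"
      if t: "0 < t" "t < d" for t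
    proof -
      \<comment> \<open>On the orbit the difference compares \<open>u\<close> composed with
        \<open>g\<close> at parameters \<open>t\<close> apart, so one \<open>d\<close> serves all
        starting points; elsewhere it is 0.\<close>
      have *: "\<bar>transition_semigroup (orbit_flow g) t u x - u x\<bar> \<le> e / 2" for x
      proof (cases "x \<in> range g")
        case True
        then obtain r where "x = g r" by blast
        then show ?thesis
          using t d[of "r + t" r] by (simp add: transition_semigroup_def flow_on_orbit dist_real_def)
      next
        case False
        then show ?thesis using \<open>e > 0\<close> by (simp add: transition_semigroup_def flow_off_orbit)
      qed
      have "sup_norm (\<lambda>x. transition_semigroup (orbit_flow g) t u x - u x) \<le> e / 2"
        by (rule sup_norm_le) (rule *)
      moreover have "0 \<le> sup_norm (\<lambda>x. transition_semigroup (orbit_flow g) t u x - u x)"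
        by (rule sup_norm_nonneg) (rule *)
      ultimately show ?thesis using \<open>e > 0\<close> by simp
    qed
    then show "\<forall>\<^sub>F t in at_right 0.
        dist (sup_norm (\<lambda>x. transition_semigroup (orbit_flow g) t u x - u x)) 0 < e"
      unfolding eventually_at_right_field using \<open>d > 0\<close> by blast
  qed
qed

end

lemma feller_expandable_increasing:
  assumes cont: "continuous_on {0..} p" and det: "state_determined p" and mono: "mono_on {0..} p"
  shows "feller_expandable p"
proof -
  \<comment> \<open>The path \<open>p\<close> prolonged to negative times with slope 1, in one
    formula from which continuity and monotonicity can be read off termwise.\<close>
  define g where "g = (\<lambda>s. p (max s 0) + min s 0)"
  have pos: "g s = p s" if "s \<ge> 0" for s using that by (simp add: g_def)
  have neg: "g s = p 0 + s" if "s \<le> 0" for s using that by (simp add: g_def)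
  have above: "p 0 \<le> p s" if "s \<ge> 0" for s using monotone_onD[OF mono, of 0 s] that by simp
  interpret increasing_orbit g
  proof
    show "continuous_on UNIV g" unfolding g_def
      by (intro continuous_intros continuous_on_compose2[OF cont]) auto
    show "mono g" unfolding g_def
      by (intro monoI add_mono monotone_onD[OF mono]) auto
    show "filterlim g at_bot at_bot"
      unfolding filterlim_at_bot eventually_at_bot_linorder
    proof
      fix Z
      show "\<exists>N. \<forall>n\<le>N. g n \<le> Z" by (rule exI[of _ "min 0 (Z - p 0)"]) (auto simp: neg)
    qed
  next
    fix a b h :: real assume *: "g a = g b" "0 \<le> h"
    \<comment> \<open>At negative times \<open>g\<close> is injective and lies strictly below
      \<open>p 0\<close>, the minimum of \<open>p\<close>, so a coincidence involving a negative
      time is trivial.\<close>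
    then consider "a = b" | "a \<ge> 0" "b \<ge> 0"
      using above[of a] above[of b] pos[of a] pos[of b] neg[of a] neg[of b] by fastforce
    then show "g (a + h) = g (b + h)"
      using * by cases (auto simp: pos intro: state_determinedD[OF det])
  qed
  have "orbit_flow g (p 0) t = p t" if "t \<ge> 0" for t
    using flow_on_orbit[OF that, of 0] pos[of 0] pos[OF that] by simp
  then show ?thesis using flow_feller unfolding feller_expandable_def by blast
qed

section \<open>Reflection\<close>

lemma cadlag_minus: "cadlag p \<Longrightarrow> cadlag (\<lambda>t. - p t)"
  unfolding cadlag_def by (blast intro: tendsto_minus)

lemma C_infty_minus:
  assumes "u \<in> C_infty"
  shows "(\<lambda>x. u (- x)) \<in> C_infty"
proof -
  have "continuous_on UNIV (\<lambda>x. u (- x))"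
    by (rule continuous_on_compose2[OF C_inftyD(1)[OF assms]]) (auto intro: continuous_intros)
  moreover have "((\<lambda>x. u (- x)) \<longlongrightarrow> 0) at_top" "((\<lambda>x. u (- x)) \<longlongrightarrow> 0) at_bot"
    using filterlim_compose[OF C_inftyD(3)[OF assms] filterlim_uminus_at_bot_at_top]
      filterlim_compose[OF C_inftyD(2)[OF assms] filterlim_uminus_at_top_at_bot] by blast+
  ultimately show ?thesis
    by (simp add: C_infty_def at_infinity_eq_at_top_bot filterlim_sup)
qed

lemma sup_norm_minus: "sup_norm (\<lambda>x. v (- x)) = sup_norm v"
proof -
  have "surj (uminus :: real \<Rightarrow> real)" by (rule surjI) (rule minus_minus)
  then have "range (\<lambda>x. \<bar>v (- x)\<bar>) = range (\<lambda>x. \<bar>v x\<bar>)"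
    by (metis image_image)
  then show ?thesis by (simp only: sup_norm_def)
qed

text \<open>Conjugation by the reflection of the line preserves \<open>C_infty\<close> and the
  supremum norm; this reduces decreasing paths to increasing ones.\<close>

lemma feller_minus:
  assumes "deterministic_feller X"
  shows "deterministic_feller (\<lambda>x t. - X (- x) t)"
proof -
  let ?Y = "\<lambda>x t. - X (- x) t"
  have T: "transition_semigroup ?Y t u = (\<lambda>x. transition_semigroup X t (\<lambda>x. u (- x)) (- x))" for t u
    by (simp add: transition_semigroup_def)
  have "deterministic_markov ?Y"
    using assms cadlag_minus unfolding deterministic_feller_def deterministic_markov_def
      neg_equal_iff_equal by (simp only: minus_minus) blast
  moreover have "transition_semigroup ?Y t u \<in> C_infty" if "t \<ge> 0" "u \<in> C_infty" for t u
    unfolding T using assms that C_infty_minus by (auto simp: deterministic_feller_def)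
  moreover have "((\<lambda>t. sup_norm (\<lambda>x. transition_semigroup ?Y t u x - u x)) \<longlongrightarrow> 0) (at_right 0)"
    if "u \<in> C_infty" for u
  proof -
    have "sup_norm (\<lambda>x. transition_semigroup ?Y t u x - u x) =
        sup_norm (\<lambda>x. transition_semigroup X t (\<lambda>x. u (- x)) x - u (- x))" for t
      using sup_norm_minus[of "\<lambda>x. transition_semigroup X t (\<lambda>x. u (- x)) x - u (- x)"]
      by (simp add: T)
    then show ?thesis
      using assms C_infty_minus[OF that] by (simp add: deterministic_feller_def)
  qed
  ultimately show ?thesis by (simp add: deterministic_feller_def)
qed

lemma feller_expandable_minus:
  assumes "feller_expandable (\<lambda>t. - p t)"
  shows "feller_expandable p"
proof -
  obtain X where "deterministic_feller X" "\<And>t. t \<ge> 0 \<Longrightarrow> X (- p 0) t = - p t"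
    using assms by (auto simp: feller_expandable_def)
  then show ?thesis unfolding feller_expandable_def
    by (intro exI[of _ "\<lambda>x t. - X (- x) t"]) (auto intro: feller_minus)
qed

theorem proposition2p10:
  fixes f :: "real \<Rightarrow> real"
  assumes "cadlag f"
  shows "feller_expandable f \<longleftrightarrow> hunt_expandable f"
proof
  assume "feller_expandable f"
  then show "hunt_expandable f"
    using feller_imp_hunt unfolding feller_expandable_def hunt_expandable_def by blast
next
  assume "hunt_expandable f"
  then obtain X where X: "deterministic_hunt X" and f: "\<And>t. t \<ge> 0 \<Longrightarrow> X (f 0) t = f t"
    by (auto simp: hunt_expandable_def)
  \<comment> \<open>Only the path started at \<open>f 0\<close> is kept from \<open>X\<close>; the
    Feller process is built anew around it.\<close>
  have "continuous_on {0..} (X (f 0))"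
    using X by (intro quasi_left_continuous_imp_continuous)
      (auto simp: deterministic_hunt_def deterministic_markov_def)
  then have cont: "continuous_on {0..} f"
    by (rule continuous_on_eq) (simp add: f)
  have det: "state_determined f"
    unfolding state_determined_def
  proof (intro allI impI)
    fix a b h :: real assume "a \<ge> 0" "b \<ge> 0" "f a = f b" "h \<ge> 0"
    moreover from this have "X (f 0) (a + h) = X (f 0) (b + h)"
      using X f unfolding deterministic_hunt_def deterministic_markov_def by metis
    ultimately show "f (a + h) = f (b + h)" by (simp add: f)
  qed
  show "feller_expandable f"
    using state_determined_monotone[OF cont det]
  proof
    assume "mono_on {0..} f"
    then show ?thesis by (rule feller_expandable_increasing[OF cont det])
  next
    assume "mono_on {0..} (\<lambda>t. - f t)"
    then have "feller_expandable (\<lambda>t. - f t)"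
      using cont det
      by (intro feller_expandable_increasing continuous_on_minus state_determined_minus)
    then show ?thesis by (rule feller_expandable_minus)
  qed
qed

end
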